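(* Let $X$ be a strictly convex normed linear space, and let $A\subseteq X$ be a nonempty bounded set. If $A$ is uniquely remotal and its closure $\overline{A}$ is M-compact, then $A$ is M-compact.
   Context: For a nonempty bounded subset $A$ of a normed linear space $X$ and $x\in X$, put $D(x,A)=\sup_{a\in A}\|x-a\|$ and $F(x,A)=\{a\in A:\|x-a\|=D(x,A)\}$. The set $A$ is called uniquely remotal if $F(x,A)$ consists of exactly one point for every $x\in X$. A sequence $\{a_n\}$ in $A$ is called maximizing (in $A$) if there is some $x\in X$ with $\|x-a_n\|\to D(x,A)$ as $n\to\infty$. The set $A$ is called M-compact if every maximizing sequence in $A$ has a subsequence converging to an element of $A$. *)

theory Defs
  imports "HOL-Analysis.Analysis"
begin

text \<open>The normed linear space is the whole type, so strict convexity is a property of the type: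
  the unit sphere contains no nondegenerate segment, expressed by midpoints.\<close>

definition strictly_convex_space :: "'a::real_normed_vector itself \<Rightarrow> bool" where
  "strictly_convex_space _ \<longleftrightarrow>
     (\<forall>x y :: 'a. norm x = 1 \<and> norm y = 1 \<and> x \<noteq> y \<longrightarrow> norm ((1 / 2) *\<^sub>R (x + y)) < 1)"

text \<open>The supremum is taken in the reals, so it is the intended one only for nonempty bounded
  sets.\<close>

definition farthest_dist :: "'a::real_normed_vector \<Rightarrow> 'a set \<Rightarrow> real" where
  "farthest_dist x A = (SUP a\<in>A. norm (x - a))"

definition farthest_points :: "'a::real_normed_vector \<Rightarrow> 'a set \<Rightarrow> 'a set" where
  "farthest_points x A = {a \<in> A. norm (x - a) = farthest_dist x A}"

definition uniquely_remotal :: "'a::real_normed_vector set \<Rightarrow> bool" where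
  "uniquely_remotal A \<longleftrightarrow> (\<forall>x. \<exists>!a. a \<in> farthest_points x A)"

definition maximizing_in :: "'a::real_normed_vector set \<Rightarrow> (nat \<Rightarrow> 'a) \<Rightarrow> bool" where
  "maximizing_in A s \<longleftrightarrow>
     (\<forall>n. s n \<in> A) \<and> (\<exists>x. (\<lambda>n. norm (x - s n)) \<longlonglongrightarrow> farthest_dist x A)"

definition M_compact :: "'a::real_normed_vector set \<Rightarrow> bool" where
  "M_compact A \<longleftrightarrow>
     (\<forall>s. maximizing_in A s \<longrightarrow> (\<exists>l\<in>A. \<exists>r. strict_mono r \<and> (s \<circ> r) \<longlonglongrightarrow> l))"

end

theory Submission
  imports Defs
begin

text \<open>A maximizing sequence of \<open>A\<close> for \<open>x\<close> is also maximizing in the closure of \<open>A\<close>, because passing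
  to the closure leaves the farthest distance \<open>D\<close> unchanged. So M-compactness of the closure gives a
  subsequential limit \<open>l\<close>, which lies in the closure and satisfies \<open>norm (x - l) = D\<close>. The issue is
  to show \<open>l \<in> A\<close>.

  For this, move the centre away from \<open>l\<close> to the reflected point \<open>y = x + (x - l)\<close>. Every point of
  \<open>A\<close> is within \<open>2 * D\<close> of \<open>y\<close>, and \<open>l\<close> is at distance exactly \<open>2 * D\<close>, so \<open>D(y, A) = 2 * D\<close>.
  Remotality provides a point \<open>a\<close> of \<open>A\<close> attaining this distance, and then the vectors \<open>x - a\<close> and
  \<open>x - l\<close>, of norm at most \<open>D\<close>, have a sum of norm \<open>2 * D\<close>. Strict convexity forces them to be equal,
  that is, \<open>l = a \<in> A\<close>.\<close>

lemma norm_le_farthest_dist: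
  assumes "bounded A" "a \<in> A"
  shows "norm (x - a) \<le> farthest_dist x A"
proof -
  have "bdd_above ((\<lambda>a. norm (x - a)) ` A)"
    using bounded_any_center[of A x] assms(1)
    by (auto simp: bdd_above_def dist_norm)
  then show ?thesis
    unfolding farthest_dist_def using assms(2) by (rule cSUP_upper2) simp
qed

lemma norm_le_farthest_dist_closure:
  assumes "bounded A" "b \<in> closure A"
  shows "norm (x - b) \<le> farthest_dist x A"
proof -
  have "closure A \<subseteq> cball x (farthest_dist x A)"
    using norm_le_farthest_dist[OF assms(1)]
    by (intro closure_minimal) (auto simp: dist_norm)
  then show ?thesis using assms(2) by (auto simp: dist_norm)
qed

lemma farthest_dist_closure:
  assumes "A \<noteq> {}" "bounded A"
  shows "farthest_dist x (closure A) = farthest_dist x A"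
proof (rule antisym)
  show "farthest_dist x (closure A) \<le> farthest_dist x A"
    unfolding farthest_dist_def[of x "closure A"]
    using assms norm_le_farthest_dist_closure[OF assms(2)] by (intro cSUP_least) auto
  show "farthest_dist x A \<le> farthest_dist x (closure A)"
    unfolding farthest_dist_def[of x A]
    using assms closure_subset norm_le_farthest_dist[OF bounded_closure[OF assms(2)]]
    by (intro cSUP_least) blast+
qed

text \<open>Strict convexity speaks of the unit sphere only. For \<open>D > 0\<close> both vectors have norm exactly
  \<open>D\<close> by the triangle inequality, so dividing by \<open>D\<close> brings them there with a midpoint of norm 1;
  for \<open>D = 0\<close> both vanish.\<close>

lemma strictly_convex_eq_if_norm_add_max:
  fixes u v :: "'a::real_normed_vector"
  assumes sc: "strictly_convex_space TYPE('a)"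
    and u: "norm u \<le> D" and v: "norm v \<le> D" and uv: "norm (u + v) = 2 * D"
  shows "u = v"
proof (cases "D = 0")
  case True
  then show ?thesis using u v by simp
next
  case False
  have D: "D > 0" using False u norm_ge_zero[of u] by linarith
  have nu: "norm u = D" and nv: "norm v = D"
    using u v uv norm_triangle_ineq[of u v] by linarith+
  let ?u = "(1 / D) *\<^sub>R u" and ?v = "(1 / D) *\<^sub>R v"
  have "norm ((1 / 2) *\<^sub>R (?u + ?v)) = 1"
    using D uv by (simp flip: scaleR_add_right)
  moreover have "norm ?u = 1" "norm ?v = 1" using D nu nv by simp_all
  ultimately have "?u = ?v"
    using sc unfolding strictly_convex_space_def by (metis less_irrefl)
  then show ?thesis using D by simp
qed

text \<open>The reflected centre \<open>x + (x - l)\<close> sees \<open>l\<close> as its only possible farthest point in the closure;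
  since some point of \<open>A\<close> is farthest from it, that point is \<open>l\<close>.\<close>

lemma farthest_points_closure_subset:
  fixes A :: "'a::real_normed_vector set"
  assumes sc: "strictly_convex_space TYPE('a)"
    and ne: "A \<noteq> {}" and bd: "bounded A"
    and remotal: "\<And>x. farthest_points x A \<noteq> {}"
  shows "farthest_points x (closure A) \<subseteq> A"
proof
  fix l assume "l \<in> farthest_points x (closure A)"
  then have l: "l \<in> closure A" and nl: "norm (x - l) = farthest_dist x A"
    by (auto simp: farthest_points_def farthest_dist_closure[OF ne bd])
  define y where "y = x + (x - l)"
  obtain a where a: "a \<in> A" and na: "norm (y - a) = farthest_dist y A"
    using remotal[of y] by (auto simp: farthest_points_def)
  have xa: "norm (x - a) \<le> farthest_dist x A"
    using bd a by (rule norm_le_farthest_dist)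
  have split: "y - a = (x - a) + (x - l)" by (simp add: y_def)
  have "y - l = 2 *\<^sub>R (x - l)" by (simp add: y_def scaleR_2)
  then have "norm (y - l) = 2 * farthest_dist x A"
    using nl by (metis abs_numeral norm_scaleR)
  then have "2 * farthest_dist x A \<le> farthest_dist y A"
    using norm_le_farthest_dist_closure[OF bd l, of y] by simp
  then have "norm ((x - a) + (x - l)) = 2 * farthest_dist x A"
    using na split xa nl norm_triangle_ineq[of "x - a" "x - l"] by simp
  then have "x - a = x - l"
    using strictly_convex_eq_if_norm_add_max[OF sc xa] nl by simp
  then show "l \<in> A" using a by simp
qed

theorem theorem2p3:
  fixes A :: "'a::real_normed_vector set"
  assumes "strictly_convex_space TYPE('a)"
    and "A \<noteq> {}"
    and "bounded A"
    and "uniquely_remotal A"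
    and "M_compact (closure A)"
  shows "M_compact A"
  unfolding M_compact_def
proof (intro allI impI)
  fix s assume "maximizing_in A s"
  then obtain x where sA: "\<And>n. s n \<in> A"
    and lim: "(\<lambda>n. norm (x - s n)) \<longlonglongrightarrow> farthest_dist x (closure A)"
    unfolding maximizing_in_def farthest_dist_closure[OF assms(2,3)] by blast
  then have "maximizing_in (closure A) s"
    unfolding maximizing_in_def using closure_subset by blast
  then obtain l r where l: "l \<in> closure A" and r: "strict_mono r" and conv: "(s \<circ> r) \<longlonglongrightarrow> l"
    using assms(5) unfolding M_compact_def by blast
  have "(\<lambda>n. norm (x - (s \<circ> r) n)) \<longlonglongrightarrow> norm (x - l)"
    by (intro tendsto_intros conv)
  moreover have "(\<lambda>n. norm (x - (s \<circ> r) n)) \<longlonglongrightarrow> farthest_dist x (closure A)"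
    using LIMSEQ_subseq_LIMSEQ[OF lim r] by (simp add: o_def)
  ultimately have "norm (x - l) = farthest_dist x (closure A)"
    by (rule LIMSEQ_unique)
  then have "l \<in> farthest_points x (closure A)"
    using l by (simp add: farthest_points_def)
  moreover have "farthest_points z A \<noteq> {}" for z
    using assms(4) unfolding uniquely_remotal_def by blast
  ultimately have "l \<in> A"
    using farthest_points_closure_subset[OF assms(1-3)] by blast
  then show "\<exists>l\<in>A. \<exists>r. strict_mono r \<and> (s \<circ> r) \<longlonglongrightarrow> l"
    using r conv by blast
qed

end
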